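(* Let $C$ be a real constant with $0<C\leq 0.01$. For every integer $n\geq 3$ and every real number $k$ with $2\leq k\leq \frac{n}{3C}$, the following holds: if $G$ is a (simple) graph on $n$ vertices with at least $\left(1-\frac{1}{k}\right)\binom{n}{2}$ edges, then $G$ contains a clique of size at least $\frac{Ck\log n}{\log k}$ or an independent set of size at least $\frac{Ck\log n}{\log k}$.
   Context: All logarithms are taken to base $2$. A clique is a set of pairwise adjacent vertices; an independent set is a set of pairwise non-adjacent vertices. *)

theory Defs
  imports Complex_Main "HOL-Library.Ramsey"
begin

text \<open>
  A simple graph on a finite vertex set \<open>V\<close> is given by its edge set \<open>E \<subseteq> [V]\<^bsup>2\<^esup>\<close>, the
  2-element subsets of \<open>V\<close>.  Cliques and independent sets are those of \<^theory>\<open>HOL-Library.Ramsey\<close>;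
  \<^const>\<open>clique\<close> and \<^const>\<open>indep\<close> take the vertex subset first and do not require it to lie
  in \<open>V\<close>.
\<close>

end

theory Submission
  imports Defs
begin

text \<open>
  Put \<open>L = log n / log k\<close>, so that \<open>n\<close> is the \<open>L\<close>-th power of \<open>k\<close>, and suppose that all cliques and
  independent sets are smaller than \<open>T = C k L\<close>.  At least half of the vertices have at most \<open>2 n / k\<close>
  non-neighbours; let \<open>U\<close> be the set of these and \<open>W\<close> a maximum clique inside \<open>U\<close>.  By maximality every
  vertex of \<open>U - W\<close> has a non-neighbour in \<open>W\<close>, which is Turan's bound and settles \<open>L \<le> 12\<close>.
  If \<open>L > 12\<close>, then on average a vertex of \<open>U - W\<close> has only \<open>O(C L)\<close> non-neighbours in \<open>W\<close>, so most
  have at most \<open>q = O(C L)\<close> of them.  There are few subsets of \<open>W\<close> of size at most \<open>q\<close>, so many of these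
  vertices have the same set \<open>X\<close> of non-neighbours in \<open>W\<close>.  By the Erdos-Szekeres bound they contain a
  clique \<open>K\<close> of size \<open>q + 1\<close>, and replacing \<open>X\<close> by \<open>K\<close> enlarges \<open>W\<close>, a contradiction.
\<close>

section \<open>Ramsey-type bounds and the exchange argument\<close>

text \<open>The Erdos-Szekeres recursion: remove a vertex \<open>v\<close> and split the rest into
  neighbours \<open>N\<close>, where cliques can be extended by \<open>v\<close>, and non-neighbours
  \<open>N'\<close>, where independent sets can. Pascal's rule adds the two bounds; since both are
  strict, there is room for \<open>v\<close> itself.\<close>

lemma card_less_choose_if_small_cliques_indeps:
  assumes "finite A"
    and "\<And>K. K \<subseteq> A \<Longrightarrow> clique K E \<Longrightarrow> card K \<le> q"
    and "\<And>I. I \<subseteq> A \<Longrightarrow> indep I E \<Longrightarrow> card I \<le> m"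
  shows "card A < (m + q) choose q"
  using assms
proof (induction "m + q" arbitrary: m q A rule: less_induct)
  case less
  show ?case
  proof (cases "A = {}")
    case False
    then obtain v where v: "v \<in> A" by blast
    define N where "N = {u \<in> A - {v}. {u, v} \<in> E}"
    define N' where "N' = {u \<in> A - {v}. {u, v} \<notin> E}"
    have fin: "finite N" "finite N'"
      using less.prems(1) by (auto simp: N_def N'_def)
    have "A = insert v (N \<union> N')" using v by (auto simp: N_def N'_def)
    moreover have "v \<notin> N \<union> N'" "N \<inter> N' = {}" by (auto simp: N_def N'_def)
    ultimately have cA: "card A = Suc (card N + card N')"
      using fin by (simp add: card_Un_disjoint)
    \<comment> \<open>A singleton is both a clique and an independent set, so \<open>q\<close> and
      \<open>m\<close> are positive and can be decreased.\<close>
    have "1 \<le> q" using less.prems(2)[of "{v}"] v by (simp add: clique_def)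
    then obtain q' where q: "q = Suc q'" by (cases q) auto
    have "1 \<le> m" using less.prems(3)[of "{v}"] v by (simp add: indep_def)
    then obtain m' where m: "m = Suc m'" by (cases m) auto
    have "card N < (m + q') choose q'"
    proof (rule less.hyps)
      fix K assume K: "K \<subseteq> N" "clique K E"
      then have "clique (insert v K) E"
        by (auto simp: clique_def N_def insert_commute)
      moreover have "insert v K \<subseteq> A" "v \<notin> K" using K v by (auto simp: N_def)
      ultimately show "card K \<le> q'"
        using less.prems(2)[of "insert v K"] K(1) fin(1) q finite_subset[of K N] by auto
    next
      show "card I \<le> m" if "I \<subseteq> N" "indep I E" for I
        using less.prems(3)[of I] that by (auto simp: N_def)
    qed (use q fin in auto)
    moreover have "card N' < (m' + q) choose q"
    proof (rule less.hyps)
      fix I assume I: "I \<subseteq> N'" "indep I E"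
      then have "indep (insert v I) E"
        by (auto simp: indep_def N'_def insert_commute)
      moreover have "insert v I \<subseteq> A" "v \<notin> I" using I v by (auto simp: N'_def)
      ultimately show "card I \<le> m'"
        using less.prems(3)[of "insert v I"] I(1) fin(2) m finite_subset[of I N'] by auto
    next
      show "card K \<le> q" if "K \<subseteq> N'" "clique K E" for K
        using less.prems(2)[of K] that by (auto simp: N'_def)
    qed (use m fin in auto)
    ultimately show ?thesis
      by (simp add: cA q m)
  qed auto
qed

text \<open>Each factor \<open>q choose (q - i)\<close> is at least 1, so inserting it turns the sum
  over sizes into Vandermonde's. The bound is thus the same binomial as in the Erdos-Szekeres
  lemma.\<close>

lemma card_small_subsets_le:
  assumes "finite W" "card W \<le> m"
  shows "card {X. X \<subseteq> W \<and> card X \<le> q} \<le> (m + q) choose q"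
proof -
  have "{X. X \<subseteq> W \<and> card X \<le> q} = (\<Union>i\<le>q. [W]\<^bsup>i\<^esup>)"
    using assms(1) by (auto simp: nsets_def intro: finite_subset)
  then have "card {X. X \<subseteq> W \<and> card X \<le> q} = card (\<Union>i\<le>q. [W]\<^bsup>i\<^esup>)"
    by simp
  also have "\<dots> \<le> (\<Sum>i\<le>q. card ([W]\<^bsup>i\<^esup>))"
    by (rule card_UN_le) simp
  also have "\<dots> = (\<Sum>i\<le>q. card W choose i)" by simp
  also have "\<dots> \<le> (\<Sum>i\<le>q. (m choose i) * (q choose (q - i)))"
  proof (rule sum_mono)
    fix i assume "i \<in> {..q}"
    then have "1 \<le> q choose (q - i)" by (simp add: Suc_leI)
    moreover have "card W choose i \<le> m choose i" using assms(2) by (rule binomial_right_mono)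
    ultimately show "card W choose i \<le> (m choose i) * (q choose (q - i))"
      by (metis mult.right_neutral mult_le_mono)
  qed
  also have "\<dots> = (m + q) choose q" by (rule vandermonde)
  finally show ?thesis .
qed

text \<open>Classify the vertices by their set \<open>X\<close> of non-neighbours in
  \<open>W\<close>; the square is the number of classes times the class size. A clique
  \<open>K\<close> within the class of \<open>X\<close> is joined completely to
  \<open>W - X\<close>, so maximality of \<open>W\<close> forces
  \<open>card K \<le> card X \<le> q\<close>, and Erdos-Szekeres bounds the class.\<close>

lemma card_few_nonneighbours_le:
  assumes "finite U" and "W \<subseteq> U" and "clique W E" and "card W \<le> m"
    and W_max: "\<And>K. K \<subseteq> U \<Longrightarrow> clique K E \<Longrightarrow> card K \<le> card W"
    and indep_le: "\<And>I. I \<subseteq> U \<Longrightarrow> indep I E \<Longrightarrow> card I \<le> m"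
  shows "card {v \<in> U - W. card {w \<in> W. {v, w} \<notin> E} \<le> q} \<le> ((m + q) choose q)\<^sup>2"
proof -
  let ?M = "(m + q) choose q"
  define nonnb where "nonnb v = {w \<in> W. {v, w} \<notin> E}" for v
  define P where "P = {X. X \<subseteq> W \<and> card X \<le> q}"
  define A where "A X = {v \<in> U - W. nonnb v = X}" for X
  have finW: "finite W" using assms(1,2) finite_subset by blast
  have finA: "finite (A X)" for X using assms(1) by (simp add: A_def)
  have finP: "finite P" using finW by (simp add: P_def)
  have A_le: "card (A X) \<le> ?M" if X: "X \<in> P" for X
  proof -
    have "card (A X) < ?M"
    proof (rule card_less_choose_if_small_cliques_indeps)
      show "card I \<le> m" if "I \<subseteq> A X" "indep I E" for I
        using that indep_le[of I] by (auto simp: A_def)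
    next
      fix K assume K: "K \<subseteq> A X" "clique K E"
      let ?W' = "(W - X) \<union> K"
      have "clique ?W' E"
        using K \<open>clique W E\<close> by (fastforce simp: clique_def A_def nonnb_def insert_commute)
      moreover have "?W' \<subseteq> U" using K \<open>W \<subseteq> U\<close> by (auto simp: A_def)
      ultimately have "card ?W' \<le> card W" by (rule W_max[rotated])
      moreover have "card ?W' = card (W - X) + card K"
        using K finW finite_subset[OF K(1) finA] by (subst card_Un_disjoint) (auto simp: A_def)
      moreover have "card (W - X) = card W - card X" "card X \<le> card W"
        using X finW by (auto simp: P_def card_Diff_subset finite_subset card_mono)
      ultimately show "card K \<le> q" using X by (auto simp: P_def)
    qed (rule finA)
    then show ?thesis by simp
  qed
  have "{v \<in> U - W. card (nonnb v) \<le> q} \<subseteq> (\<Union>X\<in>P. A X)"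
    by (auto simp: P_def A_def nonnb_def)
  then have "card {v \<in> U - W. card (nonnb v) \<le> q} \<le> card (\<Union>X\<in>P. A X)"
    using finP finA by (intro card_mono) auto
  also have "\<dots> \<le> (\<Sum>X\<in>P. card (A X))" using finP by (rule card_UN_le)
  also have "\<dots> \<le> card P * ?M" using sum_bounded_above[of P "\<lambda>X. card (A X)" ?M] A_le by simp
  also have "\<dots> \<le> ?M * ?M"
    using card_small_subsets_le[OF finW assms(4)] by (simp add: P_def)
  finally show ?thesis by (simp add: nonnb_def power2_eq_square)
qed

section \<open>Degree counting\<close>

lemma sum_degrees_eq:
  assumes "finite V" and "F \<subseteq> [V]\<^bsup>2\<^esup>"
  shows "(\<Sum>v\<in>V. card {u \<in> V. {v, u} \<in> F}) = 2 * card F"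
proof -
  have finF: "finite F" using assms finite_imp_finite_nsets finite_subset by metis
  have "card {u \<in> V. {v, u} \<in> F} = card {e \<in> F. v \<in> e}" if "v \<in> V" for v
  proof (rule bij_betw_same_card)
    show "bij_betw (\<lambda>u. {v, u}) {u \<in> V. {v, u} \<in> F} {e \<in> F. v \<in> e}"
      unfolding bij_betw_def
    proof
      show "inj_on (\<lambda>u. {v, u}) {u \<in> V. {v, u} \<in> F}"
        by (auto simp: inj_on_def doubleton_eq_iff)
      show "(\<lambda>u. {v, u}) ` {u \<in> V. {v, u} \<in> F} = {e \<in> F. v \<in> e}"
      proof (intro equalityI subsetI)
        fix e assume e: "e \<in> {e \<in> F. v \<in> e}"
        then have "e \<in> [V]\<^bsup>2\<^esup>" using assms(2) by blast
        then obtain x y where "e = {x, y}" "x \<in> V" "y \<in> V"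
          by (elim nsets2_E)
        with e show "e \<in> (\<lambda>u. {v, u}) ` {u \<in> V. {v, u} \<in> F}"
          by (auto simp: insert_commute)
      qed auto
    qed
  qed
  then have "(\<Sum>v\<in>V. card {u \<in> V. {v, u} \<in> F}) = (\<Sum>v\<in>V. card {e \<in> F. v \<in> e})"
    by simp
  also have "\<dots> = 2 * card F"
  proof (rule sum_multicount[OF assms(1) finF], rule ballI)
    fix e assume "e \<in> F"
    then have "e \<subseteq> V" "card e = 2" using assms(2) by (auto simp: nsets_def)
    moreover from this have "{v \<in> V. v \<in> e} = e" by blast
    ultimately show "card {v \<in> V. v \<in> e} = 2" by simp
  qed
  finally show ?thesis .
qed

section \<open>Binomial and exponential estimates\<close>

text \<open>A single term of the expansion of \<open>(1 + x) ^ N\<close> is at most the whole;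
  \<open>x\<close> is left free to be tuned.\<close>

lemma choose_le_power_divide:
  fixes x :: real
  assumes "x > 0" and "q \<le> N"
  shows "real (N choose q) \<le> (1 + x) ^ N / x ^ q"
proof -
  have "real (N choose q) * x ^ q \<le> (\<Sum>i\<le>N. real (N choose i) * x ^ i)"
    using assms by (intro member_le_sum[of q "{..N}" "\<lambda>i. real (N choose i) * x ^ i"]) auto
  also have "\<dots> = (1 + x) ^ N"
    using binomial_ring[of x 1 N] by (simp add: add.commute)
  finally show ?thesis using assms by (simp add: field_simps)
qed

lemma ln_ge_half:
  fixes k :: real
  assumes "2 \<le> k"
  shows "1 / 2 \<le> ln k"
proof -
  have "1 / 2 \<le> ln (2::real)" using ln_le_minus_one[of "1 / 2 :: real"] by (simp add: ln_div)
  also have "\<dots> \<le> ln k" using assms by simp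
  finally show ?thesis .
qed

text \<open>Take \<open>x = 1 / k\<close> in the previous bound. As \<open>(m + q) / k\<close> is at
  most \<open>0.05 * L\<close> and \<open>ln k\<close> at least 1/2, the numerator contributes
  \<open>0.1 * L\<close> to the exponent; \<open>k ^ q\<close> contributes the remaining
  \<open>0.08 * L\<close>.\<close>

lemma choose_le_powr:
  fixes C k L :: real
  assumes C: "0 < C" "C \<le> 0.01" and k: "2 \<le> k" and L: "0 \<le> L"
    and m: "real m \<le> C * k * L" and q: "real q \<le> 8 * C * L"
  shows "real ((m + q) choose q) \<le> k powr (0.18 * L)"
proof -
  have CL: "C * L \<le> 0.01 * L" using C L by (intro mult_right_mono) auto
  have "real ((m + q) choose q) \<le> (1 + 1 / k) ^ (m + q) / (1 / k) ^ q"
    using k by (intro choose_le_power_divide) auto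
  also have "\<dots> = (1 + 1 / k) ^ (m + q) * k ^ q" using k by (simp add: field_simps)
  also have "\<dots> \<le> k powr (0.1 * L) * k powr (0.08 * L)"
  proof (rule mult_mono)
    have "(1 + 1 / k) ^ (m + q) \<le> exp (1 / k) ^ (m + q)"
      using k by (intro power_mono) auto
    also have "\<dots> = exp (real (m + q) / k)" by (simp flip: exp_of_nat_mult)
    also have "real (m + q) / k \<le> 0.05 * L"
    proof -
      have "8 * (C * L) * 2 \<le> 8 * (C * L) * k" using k C L by (intro mult_left_mono) auto
      moreover have "C * L * k \<le> 0.01 * L * k" using mult_right_mono[OF CL, of k] k by simp
      ultimately have "real (m + q) \<le> 0.05 * L * k" using m q by (simp add: algebra_simps)
      then show ?thesis using k by (simp add: field_simps)
    qed
    also have "0.05 * L \<le> 0.1 * L * ln k"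
    proof -
      have "0.1 * L * (1 / 2) \<le> 0.1 * L * ln k"
        using L k by (intro mult_left_mono ln_ge_half) auto
      then show ?thesis by simp
    qed
    finally show "(1 + 1 / k) ^ (m + q) \<le> k powr (0.1 * L)"
      using k by (simp add: powr_def)
    have "k ^ q = k powr real q" using k by (simp add: powr_realpow)
    also have "\<dots> \<le> k powr (0.08 * L)"
      using k q CL by (intro powr_mono) (simp_all add: mult.assoc)
    finally show "k ^ q \<le> k powr (0.08 * L)" .
  qed (use k in auto)
  also have "\<dots> = k powr (0.18 * L)" by (simp flip: powr_add)
  finally show ?thesis .
qed

text \<open>Used with \<open>k powr L = n\<close>: the first bound makes \<open>T\<close> a small
  fraction of \<open>n\<close>, the second does so for the number of vertices with few
  non-neighbours in \<open>W\<close>. In the first, one factor \<open>k powr (L / 2)\<close> pays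
  for \<open>k\<close> and the other for \<open>L\<close>.\<close>

lemma powr_bounds_large_exponent:
  fixes k L :: real
  assumes k: "2 \<le> k" and L: "12 \<le> L"
  shows "k * L \<le> 4 * k powr L" and "(k powr (0.18 * L))\<^sup>2 < 0.2 * k powr L"
proof -
  have "k powr 1 \<le> k powr (L / 2)" using k L by (intro powr_mono) auto
  then have k_le: "k \<le> k powr (L / 2)" using k by simp
  have "L / 4 = L / 2 * (1 / 2)" by simp
  also have "\<dots> \<le> L / 2 * ln k"
    using L k by (intro mult_left_mono ln_ge_half) auto
  also have "\<dots> \<le> exp (L / 2 * ln k)" using exp_ge_add_one_self[of "L / 2 * ln k"] by linarith
  finally have "L \<le> 4 * k powr (L / 2)" using k by (simp add: powr_def)
  then have "k * L \<le> k powr (L / 2) * (4 * k powr (L / 2))"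
    using k_le k L by (intro mult_mono) auto
  also have "\<dots> = 4 * k powr L" by (simp flip: powr_add)
  finally show "k * L \<le> 4 * k powr L" .
  have "(8::real) = 2 powr 3" by simp
  also have "\<dots> \<le> k powr 3" using k by (intro powr_mono2) auto
  also have "\<dots> \<le> k powr (0.64 * L)" using k L by (intro powr_mono) auto
  finally have 8: "8 \<le> k powr (0.64 * L)" .
  have "(k powr (0.18 * L))\<^sup>2 = k powr (0.36 * L)"
    by (simp add: power2_eq_square flip: powr_add)
  moreover have "k powr L = k powr (0.36 * L) * k powr (0.64 * L)"
    by (simp flip: powr_add)
  moreover have "k powr (0.36 * L) * 8 \<le> k powr (0.36 * L) * k powr (0.64 * L)"
    using 8 by (intro mult_left_mono) auto
  moreover have "0 < k powr (0.36 * L)" using k by simp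
  ultimately show "(k powr (0.18 * L))\<^sup>2 < 0.2 * k powr L" by linarith
qed

theorem theorem1:
  fixes C k :: real and n :: nat and V :: "'a set" and E :: "'a set set"
  assumes "0 < C" and "C \<le> 0.01"
    and "n \<ge> 3"
    and "2 \<le> k" and "k \<le> real n / (3 * C)"
    and "finite V" and "card V = n"
    and "E \<subseteq> [V]\<^bsup>2\<^esup>"
    and "real (card E) \<ge> (1 - 1 / k) * real (n choose 2)"
  shows "(\<exists>K\<subseteq>V. clique K E \<and> real (card K) \<ge> C * k * log 2 (real n) / log 2 k) \<or>
         (\<exists>I\<subseteq>V. indep I E \<and> real (card I) \<ge> C * k * log 2 (real n) / log 2 k)"
proof (rule ccontr)
  define L where "L = log 2 (real n) / log 2 k"
  define T where "T = C * k * L"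
  \<comment> \<open>Twice an upper bound for the average degree in the complement, so that Markov's
    inequality keeps half of the vertices in \<open>U\<close>.\<close>
  define d where "d = 2 * real n / k"
  assume neg: "\<not> ?thesis"
  have small_clique: "real (card K) < T" if "K \<subseteq> V" "clique K E" for K
    using neg that by (auto simp: T_def L_def not_le)
  have small_indep: "real (card I) < T" if "I \<subseteq> V" "indep I E" for I
    using neg that by (auto simp: T_def L_def not_le)
  have n: "real n \<ge> 3" using \<open>n \<ge> 3\<close> by simp
  have L0: "L > 0" using n \<open>2 \<le> k\<close> by (simp add: L_def)
  have n_eq: "k powr L = real n"
    using n \<open>2 \<le> k\<close> by (simp add: L_def powr_def log_def)
  have T0: "T > 0" using L0 \<open>0 < C\<close> \<open>2 \<le> k\<close> by (simp add: T_def)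
  have d0: "d > 0" using n \<open>2 \<le> k\<close> by (simp add: d_def)
  have Td: "T * d = 2 * C * L * real n" using \<open>2 \<le> k\<close> by (simp add: T_def d_def)
  note finV = \<open>finite V\<close>

  define F where "F = [V]\<^bsup>2\<^esup> - E"
  define deg where "deg v = card {u \<in> V. {v, u} \<in> F}" for v
  define U where "U = {v \<in> V. real (deg v) \<le> d}"
  have "card F = (n choose 2) - card E"
    using \<open>E \<subseteq> [V]\<^bsup>2\<^esup>\<close> finV \<open>card V = n\<close>
    by (simp add: F_def card_Diff_subset finite_subset[OF _ finite_imp_finite_nsets])
  moreover have "card E \<le> n choose 2"
    using card_mono[OF finite_imp_finite_nsets[OF finV] \<open>E \<subseteq> [V]\<^bsup>2\<^esup>\<close>] \<open>card V = n\<close> by simp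
  ultimately have "real (card F) \<le> real (n choose 2) / k"
    using assms(9) by (simp add: of_nat_diff algebra_simps)
  moreover have "(n choose 2) * 2 \<le> n * (n - 1)"
    unfolding choose_two by (rule div_times_less_eq_dividend)
  then have "(n choose 2) * 2 \<le> n * n" by (rule order_trans) simp
  then have "real ((n choose 2) * 2) \<le> real (n * n)" by (rule of_nat_mono)
  then have "real (n choose 2) * 2 \<le> real n * real n" by simp
  then have "real (n choose 2) * 2 / k \<le> real n * real n / k"
    using \<open>2 \<le> k\<close> by (intro divide_right_mono) auto
  moreover have "real n * (d / 2) = real n * real n / k" by (simp add: d_def)
  ultimately have F_le: "2 * real (card F) \<le> real n * (d / 2)"
    by linarith
  \<comment> \<open>Markov's inequality for the complement degrees.\<close>
  have "real (card (V - U)) * d = (\<Sum>v\<in>V - U. d)" by simp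
  also have "\<dots> \<le> (\<Sum>v\<in>V - U. real (deg v))" by (intro sum_mono) (auto simp: U_def)
  also have "\<dots> \<le> (\<Sum>v\<in>V. real (deg v))" using finV by (intro sum_mono2) auto
  also have "\<dots> = 2 * real (card F)"
    using arg_cong[OF sum_degrees_eq[OF finV, of F], of real]
    by (simp add: deg_def F_def)
  also note F_le
  finally have "real (card (V - U)) \<le> real n / 2" using d0 by (simp add: mult.commute)
  moreover have UV: "U \<subseteq> V" by (auto simp: U_def)
  ultimately have U_ge: "real (card U) \<ge> real n / 2"
    using card_Diff_subset[OF finite_subset[OF UV finV] UV] card_mono[OF finV UV] \<open>card V = n\<close>
    by (simp add: of_nat_diff)
  have finU: "finite U" using UV finV finite_subset by blast

  obtain W where W: "W \<subseteq> U" "clique W E"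
    and W_max: "\<And>K. K \<subseteq> U \<Longrightarrow> clique K E \<Longrightarrow> card K \<le> card W"
  proof -
    have "\<forall>K. K \<subseteq> U \<and> clique K E \<longrightarrow> card K < Suc (card U)"
      using finU by (auto simp: less_Suc_eq_le intro: card_mono)
    from ex_has_greatest_nat[of "\<lambda>K. K \<subseteq> U \<and> clique K E" "{}" card, OF _ this]
    show thesis using that by auto
  qed
  have finW: "finite W" using W(1) finU finite_subset by blast
  have W_less: "real (card W) < T" using W UV by (intro small_clique) auto
  have card_UW: "real (card (U - W)) = real (card U) - real (card W)"
    using W(1) finU by (simp add: card_Diff_subset finW card_mono of_nat_diff)

  define nonnb where "nonnb v = {w \<in> W. {v, w} \<notin> E}" for v
  \<comment> \<open>Count the non-adjacent pairs between \<open>U - W\<close> and \<open>W\<close>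
    from the side of \<open>W\<close>, whose vertices have complement degree at most
    \<open>d\<close>.\<close>
  have sum_nonnb: "(\<Sum>v\<in>U - W. real (card (nonnb v))) \<le> real (card W) * d"
  proof -
    have "(\<Sum>v\<in>U - W. card (nonnb v)) = (\<Sum>w\<in>W. card {v \<in> U - W. {v, w} \<notin> E})"
      unfolding nonnb_def using finU finW by (intro sum_multicount_gen) auto
    then have "(\<Sum>v\<in>U - W. real (card (nonnb v))) = (\<Sum>w\<in>W. real (card {v \<in> U - W. {v, w} \<notin> E}))"
      by (simp flip: of_nat_sum)
    also have "\<dots> \<le> (\<Sum>w\<in>W. d)"
    proof (rule sum_mono)
      fix w assume w: "w \<in> W"
      have "card {v \<in> U - W. {v, w} \<notin> E} \<le> deg w"
        unfolding deg_def using w W(1) UV finV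
        by (intro card_mono) (auto simp: F_def insert_commute)
      moreover have "real (deg w) \<le> d" using w W(1) by (auto simp: U_def)
      ultimately show "real (card {v \<in> U - W. {v, w} \<notin> E}) \<le> d" by linarith
    qed
    finally show ?thesis by simp
  qed
  have Wd: "real (card W) * d < 2 * C * L * real n"
    using W_less d0 mult_strict_right_mono[of "real (card W)" T d] Td by simp

  show False
  proof (cases "L \<le> 12")
    case True
    have nonnb_pos: "1 \<le> card (nonnb v)" if v: "v \<in> U - W" for v
    proof (rule ccontr)
      assume "\<not> 1 \<le> card (nonnb v)"
      then have "nonnb v = {}" using finW by (auto simp: nonnb_def card_eq_0_iff not_le less_Suc_eq_0_disj)
      then have "clique (insert v W) E"
        using W(2) by (auto simp: clique_def nonnb_def insert_commute)
      then have "card (insert v W) \<le> card W" using v W(1) by (intro W_max) auto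
      then show False using v finW by simp
    qed
    have "real (card (U - W)) = (\<Sum>v\<in>U - W. 1)" by simp
    also have "\<dots> \<le> (\<Sum>v\<in>U - W. real (card (nonnb v)))"
      using nonnb_pos by (intro sum_mono) force
    also note sum_nonnb
    \<comment> \<open>The first term bounds \<open>U - W\<close> by the non-adjacent pairs, the
      second is \<open>T\<close>, which bounds \<open>W\<close>.\<close>
    finally have half_n: "real n / 2 < 2 * (C * L * real n) + C * L * k"
      using Wd W_less U_ge card_UW by (simp add: T_def algebra_simps)
    show False
    \<comment> \<open>If \<open>k < n\<close>, the right side of \<open>half_n\<close> is at most
      \<open>0.36 * n\<close>. Otherwise \<open>L \<le> 1\<close>, and
      \<open>k \<le> n / (3 * C)\<close> bounds it by \<open>n / 50 + n / 3\<close>.\<close>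
    proof (cases "k < real n")
      case True
      have CL: "C * L \<le> 0.01 * 12" using \<open>L \<le> 12\<close> L0 assms(1,2) by (intro mult_mono) auto
      have "C * L * k \<le> C * L * real n"
        using True L0 assms(1) by (intro mult_left_mono) auto
      moreover have "C * L * real n \<le> 3 / 25 * real n" using mult_right_mono[OF CL, of "real n"] n by simp
      ultimately show False using half_n n by linarith
    next
      case False
      have "L \<le> 1" using False n \<open>2 \<le> k\<close> by (simp add: L_def)
      then have "C * L \<le> C * 1" using assms(1) by (intro mult_left_mono) auto
      then have CL: "C * L \<le> C" by simp
      have "C * L * real n \<le> 1 / 100 * real n"
        using CL assms(2) n by (intro mult_right_mono[of "C * L"]) auto
      moreover have "C * L * k \<le> C * k" using mult_right_mono[OF CL, of k] \<open>2 \<le> k\<close> by simp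
      moreover have "C * k \<le> real n / 3" using assms(1,5) by (simp add: field_simps)
      ultimately show False using half_n n by linarith
    qed
  next
    case False
    define m where "m = nat \<lfloor>T\<rfloor>"
    \<comment> \<open>The sum of \<open>card (nonnb v)\<close> is below
      \<open>2 * C * L * n\<close>, so fewer than \<open>n / 4\<close> vertices can exceed this
      threshold.\<close>
    define s where "s = 8 * C * L"
    define q where "q = nat \<lfloor>s\<rfloor>"
    define S where "S = {v \<in> U - W. card (nonnb v) \<le> q}"
    have s0: "s > 0" using L0 assms(1) by (simp add: s_def)
    have m: "real m \<le> T" and q: "real q \<le> s" using T0 s0 by (simp_all add: m_def q_def)
    have le_m: "i \<le> m" if "real i < T" for i
      using that by (simp add: m_def le_nat_floor)
    have finUW: "finite (U - W)" using finU by simp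
    have "card S \<le> ((m + q) choose q)\<^sup>2"
      unfolding S_def nonnb_def
      using finU W W_max le_m[OF W_less] le_m[OF small_indep] UV
      by (intro card_few_nonneighbours_le) auto
    then have "real (card S) \<le> (real ((m + q) choose q))\<^sup>2"
      by (metis of_nat_le_iff of_nat_power)
    also have "\<dots> \<le> (k powr (0.18 * L))\<^sup>2"
      using assms(1,2,4) L0 m q by (intro power_mono choose_le_powr) (auto simp: T_def s_def)
    also have "\<dots> < 0.2 * real n"
      using powr_bounds_large_exponent(2)[of k L] False assms(4) n_eq by simp
    finally have S_less: "real (card S) < 0.2 * real n" .

    have "real (card (U - W - S)) * s = (\<Sum>v\<in>U - W - S. s)" by simp
    also have "\<dots> \<le> (\<Sum>v\<in>U - W - S. real (card (nonnb v)))"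
    proof (rule sum_mono)
      fix v assume "v \<in> U - W - S"
      then have "\<not> card (nonnb v) \<le> q" by (auto simp: S_def)
      then have "\<not> real (card (nonnb v)) \<le> s" by (auto simp: q_def le_nat_floor)
      then show "s \<le> real (card (nonnb v))" by simp
    qed
    also have "\<dots> \<le> (\<Sum>v\<in>U - W. real (card (nonnb v)))"
      using finUW by (intro sum_mono2) auto
    also note sum_nonnb
    also note Wd
    also have "2 * C * L * real n = (real n / 4) * s" by (simp add: s_def)
    finally have "real (card (U - W - S)) < real n / 4" using s0 by simp
    moreover have "U - W = (U - W - S) \<union> S" by (auto simp: S_def)
    then have "card (U - W) \<le> card (U - W - S) + card S" by (metis card_Un_le)
    moreover have "T \<le> 0.04 * real n"
    proof -
      have "T = C * (k * L)" by (simp add: T_def)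
      also have "\<dots> \<le> 0.01 * (4 * real n)"
        using powr_bounds_large_exponent(1)[of k L] False n_eq assms(1,2,4) L0
        by (intro mult_mono[of C _ "k * L"]) auto
      finally show ?thesis by simp
    qed
    \<comment> \<open>\<open>U - W\<close> has fewer than \<open>n / 4 + n / 5 = 0.45 * n\<close>
      vertices, but also more than \<open>n / 2 - 0.04 * n = 0.46 * n\<close>.\<close>
    ultimately show False using S_less U_ge card_UW W_less n by simp
  qed
qed

end
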